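(* Let $C\ge 2$ be an integer and for each $n$ let $X=X^{(n)}=(X_{ij})_{1\le i,j\le n}$ be uniformly distributed on $\mathscr M(Cn,n)$. For any fixed $\varepsilon>0$, $$\lim_{n\to\infty}\mathbb P\left(\max_{1\le i,j\le n}X_{ij}>\frac{1}{\log\left(\frac{C+1}{C}\right)}\log\left(\frac{C}{1+C}\cdot n^{2+\varepsilon}\right)\right)=0.$$
   Context: $\mathscr M(Cn,n)$ denotes the (finite) set of $n\times n$ matrices with non-negative integer entries all of whose row sums and column sums are equal to $Cn$. *)

theory Defs
  imports "HOL-Probability.Probability" "Jordan_Normal_Form.Matrix"
begin

text \<open>Indices are 0-based: the entries of an n by n matrix are \<open>A $$ (i,j)\<close> with \<open>i, j < n\<close>.\<close>

definition uniform_margin_mats :: "nat \<Rightarrow> nat \<Rightarrow> nat mat set" where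
  "uniform_margin_mats s n =
     {A \<in> carrier_mat n n.
        (\<forall>i<n. (\<Sum>j<n. A $$ (i,j)) = s) \<and> (\<forall>j<n. (\<Sum>i<n. A $$ (i,j)) = s)}"

text \<open>\<open>pmf_of_set\<close> is the uniform distribution only on finite nonempty sets, hence the next two facts.\<close>

lemma finite_uniform_margin_mats: "finite (uniform_margin_mats s n)"
proof -
  have "uniform_margin_mats s n \<subseteq> mat n n ` (({..<n} \<times> {..<n}) \<rightarrow>\<^sub>E {..s})"
  proof
    fix A assume A: "A \<in> uniform_margin_mats s n"
    define f where "f = restrict (\<lambda>ij. A $$ ij) ({..<n} \<times> {..<n})"
    have "A $$ (i,j) \<le> s" if "i < n" "j < n" for i j
    proof -
      have "A $$ (i,j) \<le> (\<Sum>j<n. A $$ (i,j))"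
        using that by (intro member_le_sum) auto
      with A that show ?thesis by (auto simp: uniform_margin_mats_def)
    qed
    then have "f \<in> ({..<n} \<times> {..<n}) \<rightarrow>\<^sub>E {..s}"
      by (auto simp: f_def)
    moreover have "A = mat n n f"
      using A by (intro eq_matI) (auto simp: f_def uniform_margin_mats_def)
    ultimately show "A \<in> mat n n ` (({..<n} \<times> {..<n}) \<rightarrow>\<^sub>E {..s})" by blast
  qed
  then show ?thesis by (rule finite_subset) (auto intro!: finite_imageI finite_PiE)
qed

lemma uniform_margin_mats_nonempty: "uniform_margin_mats (C * n) n \<noteq> {}"
proof -
  have "mat n n (\<lambda>_. C) \<in> uniform_margin_mats (C * n) n"
    by (auto simp: uniform_margin_mats_def mult.commute)
  then show ?thesis by blast
qed

end

theory Submission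
  imports Defs "HOL-Real_Asymp.Real_Asymp"
begin

text \<open>
  Let \<open>N(r, c)\<close> be the number of non-negative integer tables with row sums \<open>r\<close> and column sums \<open>c\<close>.
  Subtracting \<open>k\<close> from the entry \<open>(p, q)\<close> identifies the tables with \<open>X\<^bsub>pq\<^esub> \<ge> k\<close> with those
  whose margins at \<open>p\<close> and \<open>q\<close> are lowered by \<open>k\<close>. Moving one unit from a larger to a smaller
  margin does not decrease \<open>N\<close>: with all other rows fixed, two rows are filled by bounded
  compositions, whose number is symmetric and unimodal in the prescribed sum. This has two
  consequences. Among all margins with the same total \<open>m\<close> the constant ones maximise \<open>N\<close>, so at
  least a fraction \<open>(m + 1)\<close> to the power \<open>- 2 n\<close> of all \<open>n\<close> by \<open>n\<close> tables with total \<open>m\<close> have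
  constant margins. And in a row and a column with minimal sums, \<open>X\<^bsub>pq\<^esub> > 0\<close> is at most as likely
  as for an average entry.

  Hence, for the lowered margins, \<open>P(X\<^bsub>pq\<^esub> > k | X\<^bsub>pq\<^esub> \<ge> k)\<close> is at most the expected
  proportion of nonzero entries. A uniform table with total \<open>C n\<^sup>2\<close> has a proportion of nonzero
  entries above \<open>\<theta> > C / (C + 1)\<close> only with probability exponentially small in \<open>n\<^sup>2\<close>, which absorbs
  the factor \<open>(m + 1)\<close> to the power \<open>2 n\<close>. So \<open>P(X\<^bsub>pq\<^esub> \<ge> k)\<close> is at most \<open>\<theta>\<^sup>k\<close> up to a negligible
  error, and a union bound over the entries concludes.
\<close>

subsection \<open>Compositions\<close>

text \<open>Weak compositions, with zero parts allowed. The value 0 off \<open>S\<close> makes the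
  function unique and, for finite \<open>S\<close>, the set finite.\<close>

definition compositions :: "'a set \<Rightarrow> nat \<Rightarrow> ('a \<Rightarrow> nat) set" where
  "compositions S m = {f. (\<forall>x. x \<notin> S \<longrightarrow> f x = 0) \<and> sum f S = m}"

lemma compositions_le:
  assumes "finite S" "f \<in> compositions S m"
  shows "f x \<le> m"
proof (cases "x \<in> S")
  case True
  then show ?thesis
    using assms member_le_sum[of x S f] by (auto simp: compositions_def)
qed (use assms in \<open>auto simp: compositions_def\<close>)

lemma compositions_subset_PiE_dflt:
  assumes "finite S"
  shows "compositions S m \<subseteq> PiE_dflt S 0 (\<lambda>_. {..m})"
  using compositions_le[OF assms] by (auto simp: PiE_dflt_def compositions_def)

lemma finite_compositions: "finite S \<Longrightarrow> finite (compositions S m)"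
  by (rule finite_subset[OF compositions_subset_PiE_dflt]) (auto intro: finite_PiE_dflt)

text \<open>Every part is at most \<open>m\<close>. This crude count is applied only to vectors of
  margins, where a factor that is polynomial in \<open>m\<close> for each row and column is
  affordable.\<close>

lemma card_compositions_le:
  assumes "finite S"
  shows "card (compositions S m) \<le> (m + 1) ^ card S"
proof -
  have "card (compositions S m) \<le> card (PiE_dflt S (0::nat) (\<lambda>_. {..m}))"
    using assms by (intro card_mono compositions_subset_PiE_dflt finite_PiE_dflt) auto
  also have "\<dots> = (m + 1) ^ card S"
    using assms by (subst card_PiE_dflt) auto
  finally show ?thesis .
qed

text \<open>Stars and bars: a distinct list enumerating \<open>S\<close> turns compositions into
  lists of fixed length and sum.\<close>

lemma card_compositions:
  assumes "finite S"
  shows "card (compositions S m) = (m + card S - 1) choose m"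
proof -
  obtain xs where xs: "set xs = S" "distinct xs"
    using finite_distinct_list[OF assms] by blast
  define n where "n = length xs"
  have n: "n = card S" using xs distinct_card n_def by metis
  have len: "i < n \<Longrightarrow> xs ! i \<in> S" for i using xs n_def by auto
  have inj: "inj_on ((!) xs) {..<n}" using xs by (auto simp: inj_on_def n_def nth_eq_iff_index_eq)
  have sum_list_map: "sum_list (map f xs) = sum f S" for f :: "'a \<Rightarrow> nat"
    using sum_list_distinct_conv_sum_set[OF xs(2), of f] xs(1) by simp
  have "bij_betw (\<lambda>f. map f xs) (compositions S m) {l. length l = n \<and> sum_list l = m}"
  proof (rule bij_betwI')
    fix f g assume fg: "f \<in> compositions S m" "g \<in> compositions S m"
    have "f = g" if "map f xs = map g xs"
    proof
      fix x
      show "f x = g x"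
        using that fg xs(1) by (cases "x \<in> S") (simp_all add: compositions_def)
    qed
    then show "(map f xs = map g xs) = (f = g)" by blast
  next
    fix f assume "f \<in> compositions S m"
    then show "map f xs \<in> {l. length l = n \<and> sum_list l = m}"
      using sum_list_map[of f] by (simp add: compositions_def n_def)
  next
    fix l :: "nat list" assume l: "l \<in> {l. length l = n \<and> sum_list l = m}"
    define g where "g = the_inv_into {..<n} ((!) xs)"
    define f where "f = (\<lambda>x. if x \<in> S then l ! g x else 0)"
    have g: "i < n \<Longrightarrow> g (xs ! i) = i" for i
      unfolding g_def using inj by (intro the_inv_into_f_f) auto
    have l_eq: "l = map f xs"
      using l len g by (intro nth_equalityI) (simp_all add: n_def f_def)
    moreover have "sum f S = m"
      using l l_eq sum_list_map[of f] by simp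
    then have "f \<in> compositions S m"
      unfolding compositions_def by (auto simp: f_def)
    ultimately show "\<exists>f\<in>compositions S m. l = map f xs" by blast
  qed
  then have "card (compositions S m) = card {l::nat list. length l = n \<and> sum_list l = m}"
    by (rule bij_betw_same_card)
  then show ?thesis by (simp add: card_length_sum_list n)
qed

text \<open>With \<open>N + 1\<close> cells the counts for totals \<open>j\<close> and
  \<open>j + 1\<close> have ratio (j + 1) / (j + 1 + N), which increases with \<open>j\<close> and
  thus is at most m / (m + N).\<close>

lemma card_compositions_pred:
  assumes "finite S" "S \<noteq> {}" "j < m"
  shows "card (compositions S j) * (m + card S - 1) \<le> m * card (compositions S (Suc j))"
proof -
  obtain N where N: "card S = Suc N" using assms by (cases "card S") auto
  have absorb: "Suc j * (Suc (j + N) choose Suc j) = Suc (j + N) * ((j + N) choose j)"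
    by (rule Suc_times_binomial)
  have ineq: "Suc j * (m + N) \<le> m * Suc (j + N)"
    using mult_le_mono2[of "Suc j" m N] assms(3) by (simp add: algebra_simps)
  have "Suc j * (((j + N) choose j) * (m + N)) \<le> ((j + N) choose j) * (m * Suc (j + N))"
    using mult_le_mono2[OF ineq, of "(j + N) choose j"] by (simp only: ac_simps)
  also have "\<dots> = Suc j * (m * (Suc (j + N) choose Suc j))"
    using arg_cong[OF absorb, of "\<lambda>x. m * x"] by (simp only: ac_simps)
  finally have "((j + N) choose j) * (m + N) \<le> m * (Suc (j + N) choose Suc j)"
    by (simp only: mult_le_cancel1)
  then show ?thesis using assms N by (simp add: card_compositions)
qed

text \<open>The ratio bound, iterated \<open>q\<close> times, is the same for all totals up to
  \<open>m\<close>. For m = C n^2 and n^2 cells it is close to C / (C + 1), the source of this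
  constant.\<close>

lemma card_compositions_diff:
  assumes "finite S" "S \<noteq> {}" "q \<le> j" "j \<le> m"
  shows "card (compositions S (j - q)) * (m + card S - 1) ^ q \<le> m ^ q * card (compositions S j)"
  using assms(3)
proof (induction q)
  case (Suc q)
  have "card (compositions S (j - Suc q)) * (m + card S - 1) ^ Suc q
      = card (compositions S (j - Suc q)) * (m + card S - 1) * (m + card S - 1) ^ q" by simp
  also have "\<dots> \<le> m * card (compositions S (Suc (j - Suc q))) * (m + card S - 1) ^ q"
    using assms Suc.prems by (intro mult_right_mono card_compositions_pred) auto
  also have "Suc (j - Suc q) = j - q" using Suc.prems by simp
  also have "m * card (compositions S (j - q)) * (m + card S - 1) ^ q
      \<le> m * (m ^ q * card (compositions S j))"
    using Suc by (simp only: mult.assoc) (intro mult_left_mono, auto)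
  finally show ?case by (simp only: power_Suc mult.assoc)
qed simp

lemma card_compositions_mono:
  assumes "finite S" "S \<noteq> {}" "j \<le> m"
  shows "card (compositions S j) \<le> card (compositions S m)"
proof -
  obtain N where N: "card S = Suc N" using assms by (cases "card S") auto
  have "(j + N) choose N \<le> (m + N) choose N" using assms by (intro binomial_right_mono) auto
  moreover have "(i + N) choose i = (i + N) choose N" for i
    using binomial_symmetric[of i "i + N"] by simp
  ultimately show ?thesis using assms N by (simp add: card_compositions)
qed

section \<open>Compositions with large support\<close>

definition support_in :: "'a set \<Rightarrow> ('a \<Rightarrow> nat) \<Rightarrow> 'a set" where
  "support_in S f = {x \<in> S. 0 < f x}"

text \<open>Lowering \<open>f\<close> by one on \<open>Q\<close> is a bijection;
  \<open>q \<le> m\<close> keeps the new total from being truncated.\<close>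

lemma card_compositions_pos_on:
  assumes "finite S" "Q \<subseteq> S" "card Q = q" "q \<le> m"
  shows "card {f \<in> compositions S m. \<forall>x\<in>Q. 0 < f x} = card (compositions S (m - q))"
proof -
  let ?A = "{f \<in> compositions S m. \<forall>x\<in>Q. 0 < f x}"
  let ?d = "\<lambda>f x. f x - (if x \<in> Q then 1 else 0 :: nat)"
  let ?u = "\<lambda>f x. f x + (if x \<in> Q then 1 else 0 :: nat)"
  have q: "(\<Sum>x\<in>S. if x \<in> Q then 1 else 0 :: nat) = q"
    using assms by (subst sum.inter_restrict[symmetric]) (auto simp: Int_absorb1)
  have "bij_betw ?d ?A (compositions S (m - q))"
  proof (rule bij_betw_byWitness[where f' = ?u])
    show "\<forall>f\<in>?A. ?u (?d f) = f"
      by (auto simp: fun_eq_iff)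
    show "\<forall>f\<in>compositions S (m - q). ?d (?u f) = f" by (auto simp: fun_eq_iff)
    show "?d ` ?A \<subseteq> compositions S (m - q)"
    proof safe
      fix f assume f: "f \<in> compositions S m" "\<forall>x\<in>Q. 0 < f x"
      have "sum (?d f) S = sum f S - (\<Sum>x\<in>S. if x \<in> Q then 1 else 0)"
        using f(2) by (intro sum_subtractf_nat) (auto simp: Suc_le_eq)
      with f show "?d f \<in> compositions S (m - q)" by (simp add: compositions_def q)
    qed
    show "?u ` compositions S (m - q) \<subseteq> ?A"
      using assms q by (auto simp: compositions_def sum.distrib)
  qed
  then show ?thesis by (rule bij_betw_same_card)
qed

lemma card_compositions_large_support:
  assumes "finite S" "q \<le> m"
  shows "card {f \<in> compositions S m. z \<le> card (support_in S f)} * (z choose q)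
      \<le> (card S choose q) * card (compositions S (m - q))"
proof -
  \<comment> \<open>Double counting of the pairs of a composition and a \<open>q\<close>-subset of its support.\<close>
  let ?W = "compositions S m" and ?Q = "{Q. Q \<subseteq> S \<and> card Q = q}"
  have fin: "finite ?W" "finite ?Q" using assms by (auto simp: finite_compositions)
  have "card {f \<in> ?W. z \<le> card (support_in S f)} * (z choose q)
      = (\<Sum>f\<in>{f \<in> ?W. z \<le> card (support_in S f)}. z choose q)" by simp
  also have "\<dots> \<le> (\<Sum>f\<in>{f \<in> ?W. z \<le> card (support_in S f)}. card (support_in S f) choose q)"
    by (intro sum_mono binomial_right_mono) auto
  also have "\<dots> \<le> (\<Sum>f\<in>?W. card (support_in S f) choose q)"
    using fin by (intro sum_mono2) auto
  also have "\<dots> = (\<Sum>f\<in>?W. card {Q \<in> ?Q. \<forall>x\<in>Q. 0 < f x})"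
  proof (intro sum.cong refl)
    fix f
    have "{Q \<in> ?Q. \<forall>x\<in>Q. 0 < f x} = {Q. Q \<subseteq> support_in S f \<and> card Q = q}"
      by (auto simp: support_in_def)
    then show "card (support_in S f) choose q = card {Q \<in> ?Q. \<forall>x\<in>Q. 0 < f x}"
      using assms by (simp add: n_subsets support_in_def)
  qed
  also have "\<dots> = (\<Sum>Q\<in>?Q. card {f \<in> ?W. \<forall>x\<in>Q. 0 < f x})"
    using sum.swap_restrict[OF fin, of "\<lambda>_ _. 1::nat" "\<lambda>f Q. \<forall>x\<in>Q. 0 < f x"] by simp
  also have "\<dots> = (\<Sum>Q\<in>?Q. card (compositions S (m - q)))"
    using assms by (intro sum.cong refl card_compositions_pos_on) auto
  finally show ?thesis using assms by (simp add: n_subsets)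
qed

text \<open>The right side is a falling factorial with \<open>k\<close> factors, each at least
  \<open>n - k\<close>. If \<open>k > n\<close>, both sides are 0.\<close>

lemma power_le_binomial_times_fact: "(n - k) ^ k \<le> (n choose k) * fact k"
proof (induction k arbitrary: n)
  case (Suc k)
  show ?case
  proof (cases n)
    case (Suc n')
    have "(n - Suc k) ^ Suc k \<le> Suc n' * (n' - k) ^ k"
      unfolding Suc diff_Suc_Suc power_Suc by (intro mult_right_mono) auto
    also have "\<dots> \<le> Suc n' * ((n' choose k) * fact k)"
      by (intro mult_left_mono Suc.IH) auto
    also have "\<dots> = (Suc k * (Suc n' choose Suc k)) * fact k"
      by (simp only: Suc_times_binomial mult.assoc)
    also have "\<dots> = (n choose Suc k) * fact (Suc k)"
      using Suc by (simp only: fact_Suc of_nat_id ac_simps)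
    finally show ?thesis .
  qed simp
qed simp

text \<open>After multiplication by \<open>fact q\<close> both binomial coefficients are compared
  with powers, so that the bound decays geometrically in \<open>q\<close>.\<close>

lemma card_compositions_large_support_power:
  assumes "finite S" "q \<le> m"
  shows "card {f \<in> compositions S m. z \<le> card (support_in S f)} * (z - q) ^ q
      \<le> card S ^ q * card (compositions S (m - q))" (is "?a * _ \<le> _ * ?b")
proof -
  have "?a * (z - q) ^ q \<le> ?a * ((z choose q) * fact q)"
    by (intro mult_left_mono power_le_binomial_times_fact) auto
  also have "\<dots> = (?a * (z choose q)) * fact q" by simp
  also have "\<dots> \<le> ((card S choose q) * ?b) * fact q"
    by (intro mult_right_mono card_compositions_large_support assms) auto
  also have "\<dots> = ((card S choose q) * fact q) * ?b" by simp
  also have "\<dots> \<le> card S ^ q * ?b"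
    by (intro mult_right_mono binomial_fact_pow) auto
  finally show ?thesis .
qed

subsection \<open>Bounded compositions\<close>

text \<open>The total is an integer so that shifting it downwards is never truncated.\<close>

definition bounded_compositions :: "'a set \<Rightarrow> ('a \<Rightarrow> nat) \<Rightarrow> int \<Rightarrow> ('a \<Rightarrow> nat) set" where
  "bounded_compositions S b m =
     {f. (\<forall>x. x \<notin> S \<longrightarrow> f x = 0) \<and> (\<forall>x\<in>S. f x \<le> b x) \<and> int (sum f S) = m}"

lemma finite_bounded_compositions:
  assumes "finite S"
  shows "finite (bounded_compositions S b m)"
proof (rule finite_subset)
  show "bounded_compositions S b m \<subseteq> PiE_dflt S 0 (\<lambda>x. {..b x})"
    by (auto simp: bounded_compositions_def PiE_dflt_def)
qed (use assms in \<open>auto intro: finite_PiE_dflt\<close>)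

lemma card_bounded_compositions_insert:
  assumes "finite S" "x \<notin> S"
  shows "card (bounded_compositions (insert x S) b m)
       = (\<Sum>t\<le>b x. card (bounded_compositions S b (m - int t)))"
proof -
  let ?B = "SIGMA t:{..b x}. bounded_compositions S b (m - int t)"
  have upd: "sum (f(x := t)) S = sum f S" for f t
    using assms by (intro sum.cong) auto
  have "bij_betw (\<lambda>f. (f x, f(x := 0))) (bounded_compositions (insert x S) b m) ?B"
  proof (rule bij_betw_byWitness[where f' = "\<lambda>(t, f). f(x := t)"])
    show "\<forall>p\<in>?B. (\<lambda>f. (f x, f(x := 0))) ((\<lambda>(t, f). f(x := t)) p) = p"
      using assms by (auto simp: bounded_compositions_def fun_eq_iff)
    show "(\<lambda>f. (f x, f(x := 0))) ` bounded_compositions (insert x S) b m \<subseteq> ?B"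
    proof safe
      fix f assume f: "f \<in> bounded_compositions (insert x S) b m"
      then show "f(x := 0) \<in> bounded_compositions S b (m - int (f x))"
        using assms upd[of f 0] by (simp add: bounded_compositions_def del: of_nat_sum)
    qed (auto simp: bounded_compositions_def)
    show "(\<lambda>(t, f). f(x := t)) ` ?B \<subseteq> bounded_compositions (insert x S) b m"
    proof safe
      fix t f assume "t \<le> b x" and f: "f \<in> bounded_compositions S b (m - int t)"
      moreover have "sum (f(x := t)) (insert x S) = t + sum f S"
        unfolding sum.insert[OF assms] upd by simp
      ultimately show "f(x := t) \<in> bounded_compositions (insert x S) b m"
        using assms by (auto simp: bounded_compositions_def simp del: sum.insert of_nat_sum)
    qed
  qed auto
  then have "card (bounded_compositions (insert x S) b m) = card ?B"
    by (rule bij_betw_same_card)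
  then show ?thesis
    by (simp add: card_SigmaI finite_bounded_compositions assms)
qed

text \<open>The complement \<open>b - f\<close> gives the symmetry of the counts about half of
  \<open>sum b S\<close>.\<close>

lemma card_bounded_compositions_reflect:
  assumes "finite S"
  shows "card (bounded_compositions S b (int (sum b S) - m)) = card (bounded_compositions S b m)"
proof -
  let ?r = "\<lambda>f x. if x \<in> S then b x - f x else 0"
  have sub: "?r ` bounded_compositions S b m \<subseteq> bounded_compositions S b (int (sum b S) - m)" for m
  proof safe
    fix f assume f: "f \<in> bounded_compositions S b m"
    then have "sum (?r f) S = sum b S - sum f S"
      by (simp add: bounded_compositions_def sum_subtractf_nat)
    moreover have "sum f S \<le> sum b S"
      using f by (intro sum_mono) (auto simp: bounded_compositions_def)
    ultimately show "?r f \<in> bounded_compositions S b (int (sum b S) - m)"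
      using f by (simp add: bounded_compositions_def of_nat_diff del: of_nat_sum)
  qed
  have "bij_betw ?r (bounded_compositions S b m) (bounded_compositions S b (int (sum b S) - m))"
    using sub[of m] sub[of "int (sum b S) - m"]
    by (intro bij_betw_byWitness[where f' = ?r]) (auto simp: bounded_compositions_def fun_eq_iff)
  then show ?thesis by (simp add: bij_betw_same_card)
qed

text \<open>Symmetric unimodality: the hypotheses say that \<open>v\<close> is at least as close to
  the centre as \<open>u\<close>. Adding a cell convolves the counts with an interval, which
  preserves this property.\<close>

lemma card_bounded_compositions_mono:
  assumes "finite S" "u \<le> v" "u + v \<le> int (sum b S)"
  shows "card (bounded_compositions S b u) \<le> card (bounded_compositions S b v)"
  using assms
proof (induction S arbitrary: u v rule: finite_induct)
  case empty
  then have "bounded_compositions {} b u = {} \<or> u = v"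
    by (auto simp: bounded_compositions_def)
  then show ?case by auto
next
  case (insert x S)
  let ?h = "\<lambda>m. card (bounded_compositions S b m)"
  let ?H = "\<lambda>m. card (bounded_compositions (insert x S) b m)"
  \<comment> \<open>The sums for \<open>m\<close> and \<open>m + 1\<close> share all terms but
    \<open>?h (m - int (b x))\<close> and \<open>?h (m + 1)\<close>. These arguments add up to
    \<open>2 * m + 1 - int (b x)\<close>, so the induction hypothesis compares them.\<close>
  have step: "?H m \<le> ?H (m + 1)" if "2 * m + 1 \<le> int (sum b (insert x S))" for m
  proof -
    have "?H m = (\<Sum>t<b x. ?h (m - int t)) + ?h (m - int (b x))"
      using insert.hyps
      by (simp add: card_bounded_compositions_insert lessThan_Suc_atMost[symmetric])
    also have "\<dots> \<le> (\<Sum>t<b x. ?h (m - int t)) + ?h (m + 1)"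
      using insert.hyps that by (intro add_left_mono insert.IH) auto
    also have "\<dots> = ?H (m + 1)"
      using insert.hyps
      by (simp add: card_bounded_compositions_insert lessThan_Suc_atMost[symmetric]
        sum.lessThan_Suc_shift algebra_simps del: sum.lessThan_Suc)
    finally show ?thesis .
  qed
  \<comment> \<open>The \<open>+ 1\<close> fits the last increment: for \<open>w + 1\<close> the
    condition becomes the \<open>2 * w + 1\<close> bound of \<open>step\<close>.\<close>
  have mono: "?H u \<le> ?H w" if "u \<le> w" "2 * w \<le> int (sum b (insert x S)) + 1" for w
    using that
  proof (induction w rule: int_ge_induct)
    case (step w)
    then show ?case using step.IH \<open>\<And>m. _ \<Longrightarrow> ?H m \<le> ?H (m + 1)\<close>[of w] by simp
  qed simp
  show ?case
  proof (cases "2 * v \<le> int (sum b (insert x S)) + 1")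
    case True
    then show ?thesis using insert.prems mono[of v] by simp
  next
    case False
    \<comment> \<open>Beyond the centre \<open>v\<close> is reflected; its mirror image is still at
      least \<open>u\<close>.\<close>
    then have "?H u \<le> ?H (int (sum b (insert x S)) - v)"
      using insert.prems by (intro mono) auto
    then show ?thesis
      using insert.hyps by (subst (asm) card_bounded_compositions_reflect) auto
  qed
qed

subsection \<open>Tables with prescribed margins\<close>

definition tables :: "'a set \<Rightarrow> 'b set \<Rightarrow> ('a \<Rightarrow> nat) \<Rightarrow> ('b \<Rightarrow> nat) \<Rightarrow> ('a \<times> 'b \<Rightarrow> nat) set" where
  "tables I J r c = {X. (\<forall>i j. i \<notin> I \<or> j \<notin> J \<longrightarrow> X (i, j) = 0) \<and>
     (\<forall>i\<in>I. (\<Sum>j\<in>J. X (i, j)) = r i) \<and> (\<forall>j\<in>J. (\<Sum>i\<in>I. X (i, j)) = c j)}"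

text \<open>Used with \<open>g\<close> recording a table outside two rows, so that only these two
  rows have to be recounted.\<close>

lemma card_le_card_fibres:
  assumes "finite A" "finite B" "\<And>y. card {x \<in> A. g x = y} \<le> card {x \<in> B. g x = y}"
  shows "card A \<le> card B"
proof -
  have fib: "card T = (\<Sum>y\<in>g ` A \<union> g ` B. card {x \<in> T. g x = y})" if "T = A \<or> T = B" for T
  proof -
    have "sum (\<lambda>_. 1) T = (\<Sum>y\<in>g ` A \<union> g ` B. sum (\<lambda>_. 1::nat) {x \<in> T. g x = y})"
      using that assms by (intro sum.group[symmetric]) auto
    then show ?thesis by simp
  qed
  show ?thesis
    unfolding fib[of A, simplified] fib[of B, simplified] by (intro sum_mono assms)
qed

definition erase_rows :: "'a set \<Rightarrow> ('a \<times> 'b \<Rightarrow> nat) \<Rightarrow> 'a \<times> 'b \<Rightarrow> nat" where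
  "erase_rows R X = (\<lambda>(i, j). if i \<in> R then 0 else X (i, j))"

text \<open>With the other rows fixed, the column sums prescribe the sum of the two free entries in
  each column. Row \<open>p\<close> is then a composition bounded by these sums, and it determines
  row \<open>q\<close>. Allowing \<open>r'\<close> to differ from \<open>r\<close> at
  \<open>p\<close> and \<open>q\<close> makes fibres for two different margins comparable.\<close>

lemma card_tables_two_row_fibre:
  fixes X :: "'a \<times> 'b \<Rightarrow> nat" and p q :: 'a
  defines "rest \<equiv> erase_rows {p, q}"
  assumes fin: "finite I" "finite J" and pq: "p \<in> I" "q \<in> I" "p \<noteq> q"
    and X: "X \<in> tables I J r c"
    and r': "r' p + r' q = r p + r q" "\<And>i. i \<in> I \<Longrightarrow> i \<noteq> p \<Longrightarrow> i \<noteq> q \<Longrightarrow> r' i = r i"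
  shows "card {Y \<in> tables I J r' c. rest Y = rest X}
       = card (bounded_compositions J (\<lambda>j. X (p, j) + X (q, j)) (int (r' p)))"
proof -
  define s where "s = (\<lambda>j. X (p, j) + X (q, j))"
  \<comment> \<open>The inverse map: it rebuilds a table in the fibre from its row
    \<open>p\<close>.\<close>
  define fill where
    "fill = (\<lambda>f (i, j). if i = p then f j else if i = q then s j - f j else X (i, j))"
  let ?A = "{Y \<in> tables I J r' c. rest Y = rest X}"
  let ?B = "bounded_compositions J s (int (r' p))"
  have split: "(\<Sum>i\<in>I. h i) = h p + h q + (\<Sum>i\<in>I - {p, q}. h i)" for h :: "'a \<Rightarrow> nat"
    using fin pq by (subst sum.subset_diff[of "{p, q}"]) (auto simp: add.commute)
  have restD: "Y (i, j) = X (i, j)" if "rest Y = rest X" "i \<noteq> p" "i \<noteq> q" for Y i j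
    using that fun_cong[OF that(1)[unfolded rest_def erase_rows_def], of "(i, j)"] by simp
  have two: "Y (p, j) + Y (q, j) = s j" if "Y \<in> ?A" "j \<in> J" for Y j
  proof -
    have "(\<Sum>i\<in>I - {p, q}. Y (i, j)) = (\<Sum>i\<in>I - {p, q}. X (i, j))"
      using that restD[of Y] by (intro sum.cong) auto
    moreover have "(\<Sum>i\<in>I. Y (i, j)) = (\<Sum>i\<in>I. X (i, j))"
      using that X by (simp add: tables_def)
    ultimately show ?thesis unfolding s_def split by simp
  qed
  have sum_s: "sum s J = r' p + r' q"
    using X pq r' by (simp add: s_def sum.distrib tables_def)
  have s0: "s j = 0" if "j \<notin> J" for j
    using X that by (simp add: s_def tables_def)
  have "bij_betw (\<lambda>Y j. Y (p, j)) ?A ?B"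
  proof (rule bij_betw_byWitness[where f' = fill])
    show "\<forall>Y\<in>?A. fill (\<lambda>j. Y (p, j)) = Y"
    proof (intro ballI ext, clarify)
      fix Y i j assume Y: "Y \<in> tables I J r' c" "rest Y = rest X"
      have "Y (q, j) = s j - Y (p, j)"
        using two[of Y j] Y s0[of j] by (cases "j \<in> J") (auto simp: tables_def)
      then show "fill (\<lambda>j. Y (p, j)) (i, j) = Y (i, j)"
        using restD[OF Y(2), of i j] by (simp add: fill_def)
    qed
    show "\<forall>f\<in>?B. (\<lambda>j. fill f (p, j)) = f" by (simp add: fill_def)
    show "(\<lambda>Y j. Y (p, j)) ` ?A \<subseteq> ?B"
    proof
      fix f assume "f \<in> (\<lambda>Y j. Y (p, j)) ` ?A"
      then obtain Y where Y: "Y \<in> ?A" and f: "f = (\<lambda>j. Y (p, j))" by blast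
      have "Y (p, j) \<le> s j" if "j \<in> J" for j using two[OF Y that] by simp
      then show "f \<in> ?B"
        using Y pq by (simp add: bounded_compositions_def tables_def f del: of_nat_sum)
    qed
    show "fill ` ?B \<subseteq> ?A"
    proof
      fix Y assume "Y \<in> fill ` ?B"
      then obtain f where f: "f \<in> ?B" and Y: "Y = fill f" by blast
      have f_le: "f j \<le> s j" if "j \<in> J" for j using f that by (simp add: bounded_compositions_def)
      have f0: "f j = 0" if "j \<notin> J" for j using f that by (simp add: bounded_compositions_def)
      have sum_f: "sum f J = r' p" using f by (simp add: bounded_compositions_def del: of_nat_sum)
      have "rest Y = rest X" by (auto simp: rest_def erase_rows_def Y fill_def fun_eq_iff)
      moreover have "Y (i, j) = 0" if "i \<notin> I \<or> j \<notin> J" for i j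
        using that X pq f0[of j] s0[of j] by (auto simp: Y fill_def tables_def)
      moreover have "(\<Sum>j\<in>J. Y (i, j)) = r' i" if "i \<in> I" for i
      proof -
        have "(\<Sum>j\<in>J. s j - f j) = r' q"
          using f_le sum_s sum_f by (simp add: sum_subtractf_nat)
        moreover have "(\<Sum>j\<in>J. X (i, j)) = r i"
          using X that by (simp add: tables_def)
        ultimately show ?thesis
          using that pq r'(2)[of i] sum_f by (cases "i = p"; cases "i = q") (simp_all add: Y fill_def)
      qed
      moreover have "(\<Sum>i\<in>I. Y (i, j)) = c j" if "j \<in> J" for j
      proof -
        have "(\<Sum>i\<in>I - {p, q}. Y (i, j)) = (\<Sum>i\<in>I - {p, q}. X (i, j))"
          by (rule sum.cong) (simp_all add: Y fill_def)
        moreover have "Y (p, j) + Y (q, j) = X (p, j) + X (q, j)"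
          using f_le[OF that] pq by (simp add: Y fill_def s_def)
        moreover have "(\<Sum>i\<in>I. X (i, j)) = c j" using X that by (simp add: tables_def)
        ultimately show ?thesis unfolding split by simp
      qed
      ultimately show "Y \<in> ?A" by (simp add: tables_def)
    qed
  qed
  then show ?thesis unfolding s_def by (rule bij_betw_same_card)
qed

section \<open>Balancing the margins\<close>

lemma finite_tables:
  assumes "finite I" "finite J"
  shows "finite (tables I J r c)"
proof (rule finite_subset)
  show "tables I J r c \<subseteq> PiE_dflt (I \<times> J) 0 (\<lambda>(i, j). {..r i})"
  proof
    fix X assume X: "X \<in> tables I J r c"
    have "X (i, j) \<le> r i" if "i \<in> I" "j \<in> J" for i j
      using X that member_le_sum[of j J "\<lambda>j. X (i, j)"] assms by (auto simp: tables_def)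
    then show "X \<in> PiE_dflt (I \<times> J) 0 (\<lambda>(i, j). {..r i})"
      using X by (auto simp: PiE_dflt_def tables_def)
  qed
qed (use assms in \<open>auto intro!: finite_PiE_dflt\<close>)

text \<open>In each fibre the sum prescribed for row \<open>p\<close> rises from \<open>r p\<close>
  to \<open>r p + 1\<close>, while the bounds have total \<open>r p + r q\<close>. As
  \<open>r p < r q\<close>, this is a step towards the centre of a unimodal sequence.\<close>

lemma card_tables_balance_rows:
  fixes r :: "'a \<Rightarrow> nat" and c :: "'b \<Rightarrow> nat"
  assumes "finite I" "finite J" "p \<in> I" "q \<in> I" "r p < r q"
  shows "card (tables I J r c) \<le> card (tables I J (r(p := r p + 1, q := r q - 1)) c)"
proof -
  let ?r = "r(p := r p + 1, q := r q - 1)"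
  let ?rest = "erase_rows {p, q} :: ('a \<times> 'b \<Rightarrow> nat) \<Rightarrow> _"
  have "p \<noteq> q" using assms by auto
  show ?thesis
  proof (rule card_le_card_fibres[where g = ?rest])
    fix Z
    show "card {X \<in> tables I J r c. ?rest X = Z} \<le> card {X \<in> tables I J ?r c. ?rest X = Z}"
    proof (cases "{X \<in> tables I J r c. ?rest X = Z} = {}")
      case True
      then show ?thesis by (simp only: card.empty)
    next
      case False
      then obtain X where X: "X \<in> tables I J r c" and Z: "Z = ?rest X" by blast
      let ?s = "\<lambda>j. X (p, j) + X (q, j)"
      have s: "sum ?s J = r p + r q"
        using X assms by (simp add: sum.distrib tables_def)
      have "card {Y \<in> tables I J r c. ?rest Y = ?rest X}
          = card (bounded_compositions J ?s (int (r p)))"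
        using assms \<open>p \<noteq> q\<close> X by (intro card_tables_two_row_fibre) auto
      also have "\<dots> \<le> card (bounded_compositions J ?s (int (?r p)))"
        using assms \<open>p \<noteq> q\<close> s by (intro card_bounded_compositions_mono) auto
      also have "\<dots> = card {Y \<in> tables I J ?r c. ?rest Y = ?rest X}"
        using assms \<open>p \<noteq> q\<close> X by (intro card_tables_two_row_fibre[symmetric]) auto
      finally show ?thesis using Z by simp
    qed
  qed (use assms in \<open>auto intro: finite_tables\<close>)
qed

lemma card_tables_transpose: "card (tables J I c r) = card (tables I J r c)"
proof -
  have "bij_betw (\<lambda>X. X \<circ> prod.swap) (tables J I c r) (tables I J r c)"
    by (rule bij_betw_byWitness[where f' = "\<lambda>X. X \<circ> prod.swap"])
       (auto simp: tables_def fun_eq_iff)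
  then show ?thesis by (rule bij_betw_same_card)
qed

lemma card_tables_balance_columns:
  assumes "finite I" "finite J" "p \<in> J" "q \<in> J" "c p < c q"
  shows "card (tables I J r c) \<le> card (tables I J r (c(p := c p + 1, q := c q - 1)))"
  using card_tables_balance_rows[OF assms(2,1,3-5), of r]
  unfolding card_tables_transpose[of J I] .

lemma card_tables_le_constant_rows:
  assumes "finite I" "finite J" "sum r I = s * card I"
  shows "card (tables I J r c) \<le> card (tables I J (\<lambda>_. s) c)"
  using assms(3)
\<comment> \<open>Truncated subtraction makes this the total deficit of the rows below
  \<open>s\<close>. Moving a unit from a row above \<open>s\<close> to one below lowers it by
  one.\<close>
proof (induction "\<Sum>i\<in>I. s - r i" arbitrary: r rule: less_induct)
  case less
  show ?case
  proof (cases "\<exists>p\<in>I. r p < s")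
    case False
    then have ge: "s \<le> r i" if "i \<in> I" for i using that by (meson not_le)
    have "r i = s" if "i \<in> I" for i
    proof (rule ccontr)
      assume "r i \<noteq> s"
      then have "sum (\<lambda>_. s) I < sum r I"
        using ge that assms by (intro sum_strict_mono_ex1) (auto simp: le_less)
      with less.prems show False by (simp add: mult.commute)
    qed
    then have "tables I J r c = tables I J (\<lambda>_. s) c" by (auto simp: tables_def)
    then show ?thesis by simp
  next
    case True
    then obtain p where p: "p \<in> I" "r p < s" by blast
    have "\<exists>q\<in>I. s < r q"
    proof (rule ccontr)
      assume "\<not> (\<exists>q\<in>I. s < r q)"
      then have "sum r I < sum (\<lambda>_. s) I"
        using p assms by (intro sum_strict_mono_ex1) (auto simp: not_less)
      with less.prems show False by (simp add: mult.commute)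
    qed
    then obtain q where q: "q \<in> I" "s < r q" by blast
    let ?r = "r(p := r p + 1, q := r q - 1)"
    have pq: "p \<noteq> q" using p q by auto
    have split: "(\<Sum>i\<in>I. h i) = h p + h q + (\<Sum>i\<in>I - {p, q}. h i)" for h :: "'a \<Rightarrow> nat"
      using assms p q pq by (subst sum.subset_diff[of "{p, q}"]) (auto simp: add.commute)
    have rest: "(\<Sum>i\<in>I - {p, q}. h (?r i)) = (\<Sum>i\<in>I - {p, q}. h (r i))" for h :: "nat \<Rightarrow> nat"
      by (intro sum.cong) auto
    have "(\<Sum>i\<in>I. s - ?r i) < (\<Sum>i\<in>I. s - r i)"
      unfolding split rest[of "\<lambda>x. s - x"] using p q pq by simp
    moreover have "sum ?r I = s * card I"
      unfolding less.prems[symmetric] split rest[of "\<lambda>x. x"] using p q pq by simp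
    ultimately have "card (tables I J ?r c) \<le> card (tables I J (\<lambda>_. s) c)"
      by (rule less.hyps)
    moreover have "card (tables I J r c) \<le> card (tables I J ?r c)"
      using assms p q by (intro card_tables_balance_rows) auto
    ultimately show ?thesis by simp
  qed
qed

lemma card_tables_le_constant:
  assumes "finite I" "finite J" "sum r I = s * card I" "sum c J = t * card J"
  shows "card (tables I J r c) \<le> card (tables I J (\<lambda>_. s) (\<lambda>_. t))"
proof -
  have "card (tables I J r c) \<le> card (tables I J (\<lambda>_. s) c)"
    using assms by (intro card_tables_le_constant_rows)
  also have "\<dots> = card (tables J I c (\<lambda>_. s))"
    by (rule card_tables_transpose)
  also have "\<dots> \<le> card (tables J I (\<lambda>_. t) (\<lambda>_. s))"
    using assms by (intro card_tables_le_constant_rows)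
  also have "\<dots> = card (tables I J (\<lambda>_. s) (\<lambda>_. t))"
    by (rule card_tables_transpose)
  finally show ?thesis .
qed

section \<open>Tables with a large or a nonzero entry\<close>

lemma card_tables_entry_ge:
  assumes fin: "finite I" "finite J" and pq: "p \<in> I" "q \<in> J" "k \<le> r p" "k \<le> c q"
  shows "card {X \<in> tables I J r c. k \<le> X (p, q)}
       = card (tables I J (r(p := r p - k)) (c(q := c q - k)))"
proof -
  let ?A = "{X \<in> tables I J r c. k \<le> X (p, q)}"
  let ?B = "tables I J (r(p := r p - k)) (c(q := c q - k))"
  let ?d = "\<lambda>X. X((p, q) := X (p, q) - k)" and ?u = "\<lambda>X. X((p, q) := X (p, q) + k)"
  \<comment> \<open>Splitting off the changed entry avoids subtraction in the margins of an updated
    table.\<close>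
  have row: "(\<Sum>j\<in>J. (X((p, q) := v)) (i, j))
      = (if i = p then (\<Sum>j\<in>J - {q}. X (p, j)) + v else (\<Sum>j\<in>J. X (i, j)))"
    for X :: "'a \<times> 'b \<Rightarrow> nat" and v i
    using sum.remove[OF fin(2) pq(2), of "\<lambda>j. (X((p, q) := v)) (i, j)"] by auto
  have row': "(\<Sum>j\<in>J. X (p, j)) = (\<Sum>j\<in>J - {q}. X (p, j)) + X (p, q)" for X :: "'a \<times> 'b \<Rightarrow> nat"
    using sum.remove[OF fin(2) pq(2), of "\<lambda>j. X (p, j)"] by simp
  have col: "(\<Sum>i\<in>I. (X((p, q) := v)) (i, j))
      = (if j = q then (\<Sum>i\<in>I - {p}. X (i, q)) + v else (\<Sum>i\<in>I. X (i, j)))"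
    for X :: "'a \<times> 'b \<Rightarrow> nat" and v j
    using sum.remove[OF fin(1) pq(1), of "\<lambda>i. (X((p, q) := v)) (i, j)"] by auto
  have col': "(\<Sum>i\<in>I. X (i, q)) = (\<Sum>i\<in>I - {p}. X (i, q)) + X (p, q)" for X :: "'a \<times> 'b \<Rightarrow> nat"
    using sum.remove[OF fin(1) pq(1), of "\<lambda>i. X (i, q)"] by simp
  have "bij_betw ?d ?A ?B"
  proof (rule bij_betw_byWitness[where f' = ?u])
    show "?d ` ?A \<subseteq> ?B"
    proof
      fix Y assume "Y \<in> ?d ` ?A"
      then obtain X where X: "X \<in> ?A" and Y: "Y = ?d X" by blast
      have "(\<Sum>j\<in>J - {q}. X (p, j)) + X (p, q) = r p" "(\<Sum>i\<in>I - {p}. X (i, q)) + X (p, q) = c q"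
        using X pq unfolding row'[symmetric] col'[symmetric] by (simp_all add: tables_def)
      then show "Y \<in> ?B"
        using X unfolding Y tables_def mem_Collect_eq row col by auto
    qed
    show "?u ` ?B \<subseteq> ?A"
    proof
      fix Y assume "Y \<in> ?u ` ?B"
      then obtain X where X: "X \<in> ?B" and Y: "Y = ?u X" by blast
      have "(\<Sum>j\<in>J - {q}. X (p, j)) + X (p, q) = r p - k" "(\<Sum>i\<in>I - {p}. X (i, q)) + X (p, q) = c q - k"
        using X pq unfolding row'[symmetric] col'[symmetric] by (simp_all add: tables_def)
      then show "Y \<in> ?A"
        using X pq unfolding Y tables_def mem_Collect_eq row col by auto
    qed
  qed auto
  then show ?thesis by (rule bij_betw_same_card)
qed

text \<open>Both sides count tables with one unit removed from a row and a column. Removing it from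
  larger margins leaves more balanced ones, hence at least as many tables.\<close>

lemma card_tables_entry_pos_le:
  assumes fin: "finite I" "finite J" and pq: "p \<in> I" "q \<in> J" "0 < r p" "0 < c q"
    and ij: "i \<in> I" "j \<in> J" "r p \<le> r i" "c q \<le> c j"
  shows "card {X \<in> tables I J r c. 0 < X (p, q)} \<le> card {X \<in> tables I J r c. 0 < X (i, j)}"
proof -
  have pos: "card {X \<in> tables I J r c. 0 < X (i, j)}
      = card (tables I J (r(i := r i - 1)) (c(j := c j - 1)))"
    if "i \<in> I" "j \<in> J" "0 < r i" "0 < c j" for i j
    using card_tables_entry_ge[of I J i j 1 r c] fin that by (simp add: Suc_le_eq)
  have "card (tables I J (r(p := r p - 1)) (c(q := c q - 1)))
      \<le> card (tables I J (r(i := r i - 1)) (c(q := c q - 1)))"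
  proof (cases "i = p")
    case False
    let ?r = "r(p := r p - 1)"
    \<comment> \<open>Lowering row \<open>i\<close> instead of row \<open>p\<close> is one balancing
      move from \<open>?r\<close>, and \<open>?r p < ?r i\<close> even when
      \<open>r p = r i\<close>.\<close>
    have "?r(p := ?r p + 1, i := ?r i - 1) = r(i := r i - 1)"
      using False pq by (auto simp: fun_eq_iff)
    then show ?thesis
      using card_tables_balance_rows[of I J p i ?r] fin pq ij False by auto
  qed simp
  also have "\<dots> \<le> card (tables I J (r(i := r i - 1)) (c(j := c j - 1)))"
  proof (cases "j = q")
    case False
    let ?c = "c(q := c q - 1)"
    have "?c(q := ?c q + 1, j := ?c j - 1) = c(j := c j - 1)"
      using False pq by (auto simp: fun_eq_iff)
    then show ?thesis
      using card_tables_balance_columns[of I J q j ?c] fin pq ij False by auto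
  qed simp
  finally show ?thesis using pos[of p q] pos[of i j] pq ij by simp
qed

text \<open>The comparison with every cell is summed over all cells; exchanging the sums counts the
  nonzero entries of each table.\<close>

lemma card_tables_min_entry_pos_le:
  assumes fin: "finite I" "finite J" and pq: "p \<in> I" "q \<in> J" "0 < r p" "0 < c q"
    and min: "\<And>i. i \<in> I \<Longrightarrow> r p \<le> r i" "\<And>j. j \<in> J \<Longrightarrow> c q \<le> c j"
  shows "card (I \<times> J) * card {X \<in> tables I J r c. 0 < X (p, q)}
      \<le> (\<Sum>X\<in>tables I J r c. card (support_in (I \<times> J) X))"
proof -
  let ?T = "tables I J r c"
  have "card {X \<in> ?T. 0 < X (p, q)} \<le> card {X \<in> ?T. 0 < X x}" if "x \<in> I \<times> J" for x
  proof -
    obtain i j where x: "x = (i, j)" "i \<in> I" "j \<in> J" using \<open>x \<in> I \<times> J\<close> by (rule SigmaE)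
    show ?thesis
      unfolding x(1) by (intro card_tables_entry_pos_le) (use fin pq min x in auto)
  qed
  then have "card (I \<times> J) * card {X \<in> ?T. 0 < X (p, q)} \<le> (\<Sum>x\<in>I \<times> J. card {X \<in> ?T. 0 < X x})"
    using sum_bounded_below[of "I \<times> J" "card {X \<in> ?T. 0 < X (p, q)}" "\<lambda>x. card {X \<in> ?T. 0 < X x}"]
    by simp
  also have "\<dots> = (\<Sum>X\<in>?T. card {x \<in> I \<times> J. 0 < X x})"
    using sum.swap_restrict[of "I \<times> J" ?T "\<lambda>_ _. 1::nat" "\<lambda>x X. 0 < X x"]
      finite_tables[OF fin] fin by simp
  finally show ?thesis by (simp add: support_in_def)
qed

section \<open>Constant margins among all tables of a given total\<close>

lemma tables_subset_compositions:
  assumes "finite I" "finite J"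
  shows "tables I J r c \<subseteq> compositions (I \<times> J) (sum r I)"
proof
  fix X assume X: "X \<in> tables I J r c"
  then have "sum X (I \<times> J) = (\<Sum>i\<in>I. \<Sum>j\<in>J. X (i, j))"
    by (simp add: sum.cartesian_product)
  with X show "X \<in> compositions (I \<times> J) (sum r I)"
    by (auto simp: compositions_def tables_def)
qed

text \<open>Each composition of \<open>m\<close> on the grid is a table for some pair of margins.
  There are at most \<open>(m + 1) ^ (card I + card J)\<close> pairs, and none has more tables than
  the constant pair.\<close>

lemma card_compositions_le_tables:
  assumes "finite I" "finite J" "m = s * card I" "m = t * card J"
  shows "card (compositions (I \<times> J) m)
      \<le> (m + 1) ^ (card I + card J) * card (tables I J (\<lambda>_. s) (\<lambda>_. t))"
proof -
  let ?P = "compositions I m \<times> compositions J m" and ?N = "card (tables I J (\<lambda>_. s) (\<lambda>_. t))"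
  have fin: "finite ?P" using assms by (simp add: finite_compositions)
  have "compositions (I \<times> J) m \<subseteq> (\<Union>(r, c)\<in>?P. tables I J r c)"
  proof
    fix X assume X: "X \<in> compositions (I \<times> J) m"
    define r where "r = (\<lambda>i. if i \<in> I then \<Sum>j\<in>J. X (i, j) else 0)"
    define c where "c = (\<lambda>j. if j \<in> J then \<Sum>i\<in>I. X (i, j) else 0)"
    have "sum r I = sum X (I \<times> J)"
      unfolding r_def by (simp add: sum.cartesian_product)
    moreover have "sum c J = sum r I"
      unfolding r_def c_def using sum.swap[of "\<lambda>j i. X (i, j)" I J] by simp
    ultimately have "(r, c) \<in> ?P" using X by (simp add: compositions_def r_def c_def)
    moreover have "X \<in> tables I J r c" using X by (auto simp: tables_def compositions_def r_def c_def)
    ultimately show "X \<in> (\<Union>(r, c)\<in>?P. tables I J r c)" by blast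
  qed
  then have "card (compositions (I \<times> J) m) \<le> card (\<Union>(r, c)\<in>?P. tables I J r c)"
    using fin assms by (intro card_mono) (auto simp: finite_tables)
  also have "\<dots> \<le> (\<Sum>(r, c)\<in>?P. card (tables I J r c))"
    using card_UN_le[OF fin, of "\<lambda>(r, c). tables I J r c"] by (simp add: case_prod_unfold)
  also have "\<dots> \<le> (\<Sum>(r, c)\<in>?P. ?N)"
    using assms by (intro sum_mono) (auto intro!: card_tables_le_constant simp: compositions_def)
  also have "\<dots> = card (compositions I m) * card (compositions J m) * ?N"
    by (simp add: case_prod_unfold card_cartesian_product)
  also have "\<dots> \<le> (m + 1) ^ card I * (m + 1) ^ card J * ?N"
    using assms by (intro mult_mono card_compositions_le) auto
  finally show ?thesis by (simp add: power_add)
qed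

subsection \<open>Tail of a single entry\<close>

text \<open>Dropping the margins leaves compositions with large support; their count is bounded
  through \<open>h\<close>-subsets of the support, the ratio estimate and the comparison with
  constant margins. Using \<open>m\<close> in place of the smaller total \<open>sum r I\<close>
  gives one bound for all lowered margins.\<close>

lemma card_tables_large_support:
  assumes fin: "finite I" "finite J" and ne: "I \<noteq> {}" "J \<noteq> {}"
    and m: "m = s * card I" "m = t * card J" and N: "N = card (I \<times> J)"
    and m0: "0 < m" and r: "sum r I \<le> m" "h \<le> sum r I" and h: "real h < y"
  shows "real (card {X \<in> tables I J r c. y \<le> real (card (support_in (I \<times> J) X))})
      \<le> (real N * real m / ((y - real h) * real (m + N - 1))) ^ h * real (m + 1) ^ (card I + card J)
          * real (card (tables I J (\<lambda>_. s) (\<lambda>_. t)))"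
proof -
  \<comment> \<open>Rounding up loses nothing, since support sizes are natural numbers.\<close>
  define z where "z = nat \<lceil>y\<rceil>"
  have z: "y \<le> real x \<longleftrightarrow> z \<le> x" for x unfolding z_def by linarith
  let ?S = "I \<times> J" and ?k = "sum r I"
  let ?a = "card {X \<in> compositions ?S ?k. z \<le> card (support_in ?S X)}"
  have S: "finite ?S" "?S \<noteq> {}" using fin ne by auto
  have N0: "0 < N" using S N by auto
  have "?a * (z - h) ^ h * (m + N - 1) ^ h
      \<le> N ^ h * card (compositions ?S (?k - h)) * (m + N - 1) ^ h"
    unfolding N using S r by (intro mult_right_mono card_compositions_large_support_power) auto
  also have "\<dots> \<le> N ^ h * (m ^ h * card (compositions ?S ?k))"
    unfolding mult.assoc N using S r by (intro mult_left_mono card_compositions_diff) auto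
  also have "\<dots> \<le> N ^ h * (m ^ h * ((m + 1) ^ (card I + card J) * card (tables I J (\<lambda>_. s) (\<lambda>_. t))))"
    using S r fin m by (intro mult_left_mono order.trans[OF card_compositions_mono
      card_compositions_le_tables]) auto
  finally have *: "real (?a * (z - h) ^ h * (m + N - 1) ^ h)
      \<le> real (N ^ h * (m ^ h * ((m + 1) ^ (card I + card J) * card (tables I J (\<lambda>_. s) (\<lambda>_. t)))))"
    by (rule of_nat_mono)
  have zh: "y - real h \<le> real (z - h)" using z[of z] h by linarith
  have pos: "0 < (y - real h) * real (m + N - 1)" using h N0 m0 by simp
  have "real ?a * ((y - real h) * real (m + N - 1)) ^ h
      \<le> real ?a * (real (z - h) * real (m + N - 1)) ^ h"
    using zh h by (intro mult_left_mono power_mono mult_right_mono mult_nonneg_nonneg) auto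
  also have "\<dots> \<le> (real N * real m) ^ h * real (m + 1) ^ (card I + card J)
      * real (card (tables I J (\<lambda>_. s) (\<lambda>_. t)))"
    using * by (simp add: power_mult_distrib mult_ac)
  finally have "real ?a \<le> (real N * real m) ^ h * real (m + 1) ^ (card I + card J)
      * real (card (tables I J (\<lambda>_. s) (\<lambda>_. t))) / ((y - real h) * real (m + N - 1)) ^ h"
    using zero_less_power[OF pos, of h] by (simp only: pos_le_divide_eq)
  moreover have "card {X \<in> tables I J r c. y \<le> real (card (support_in ?S X))} \<le> ?a"
    unfolding z using S fin tables_subset_compositions[of I J r c]
    by (intro card_mono) (auto simp: finite_compositions)
  ultimately show ?thesis by (simp add: power_divide mult_ac)
qed

text \<open>\<open>G k\<close> counts tables with margins lowered by \<open>k\<close> at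
  \<open>p\<close> and \<open>q\<close>, which are then minimal. Thus \<open>G (Suc k) / G k\<close>
  is at most their mean proportion of nonzero entries. Tables with proportion below
  \<open>\<theta>\<close> account for the first term, the exceptional ones for the second.\<close>

lemma card_tables_entry_ge_step:
  assumes fin: "finite I" "finite J" and pq: "p \<in> I" "q \<in> J"
    and m: "m = s * card I" "m = t * card J" "0 < m" and N: "N = card (I \<times> J)"
    and h: "h + s \<le> m" "real h < \<theta> * real N"
  defines "D \<equiv> (real N * real m / ((\<theta> * real N - real h) * real (m + N - 1))) ^ h
      * real (m + 1) ^ (card I + card J)"
    and "G \<equiv> \<lambda>k. real (card {X \<in> tables I J (\<lambda>_. s) (\<lambda>_. t). k \<le> X (p, q)})"
  shows "G (Suc k) \<le> \<theta> * G k + D * G 0"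
proof -
  let ?S = "I \<times> J"
  have N0: "0 < N" using fin pq N by (auto simp: card_gt_0_iff)
  have \<theta>: "0 < \<theta>"
    using h(2) N0 by (metis of_nat_0_le_iff le_less_trans zero_less_mult_pos2 of_nat_0_less_iff)
  have D0: "0 \<le> D" unfolding D_def using h(2) by (intro mult_nonneg_nonneg) auto
  have G0: "0 \<le> G k" for k by (simp add: G_def)
  show ?thesis
  proof (cases "k < s \<and> k < t")
    \<comment> \<open>Once \<open>k\<close> reaches a margin, no entry at \<open>(p, q)\<close> can
      exceed it.\<close>
    case False
    have "X (p, q) \<le> s" "X (p, q) \<le> t" if "X \<in> tables I J (\<lambda>_. s) (\<lambda>_. t)" for X
      using that pq fin member_le_sum[of q J "\<lambda>j. X (p, j)"] member_le_sum[of p I "\<lambda>i. X (i, q)"]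
      by (auto simp: tables_def)
    with False have "{X \<in> tables I J (\<lambda>_. s) (\<lambda>_. t). Suc k \<le> X (p, q)} = {}"
      by (auto simp: not_less) (meson le_trans not_less_eq_eq)+
    then have "G (Suc k) = 0" by (simp only: G_def card.empty of_nat_0)
    then show ?thesis using \<theta> D0 G0 by simp
  next
    case True
    let ?r = "(\<lambda>_. s)(p := s - k)" and ?c = "(\<lambda>_. t)(q := t - k)"
    let ?T = "tables I J ?r ?c"
    let ?Z = "\<lambda>X. card (support_in ?S X)"
    let ?L = "{X \<in> ?T. \<theta> * real N \<le> real (?Z X)}"
    have finT: "finite ?T" using fin by (rule finite_tables)
    have Gk: "G k = real (card ?T)"
      unfolding G_def using card_tables_entry_ge[of I J p q k "\<lambda>_. s" "\<lambda>_. t"] fin pq True by simp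
    have "card {X \<in> tables I J (\<lambda>_. s) (\<lambda>_. t). Suc k \<le> X (p, q)}
        = card (tables I J ((\<lambda>_. s)(p := s - Suc k)) ((\<lambda>_. t)(q := t - Suc k)))"
      using fin pq True by (intro card_tables_entry_ge) auto
    also have "\<dots> = card {X \<in> ?T. 1 \<le> X (p, q)}"
    proof -
      have "1 \<le> ?r p" "1 \<le> ?c q" using True by auto
      then show ?thesis using card_tables_entry_ge[of I J p q 1 ?r ?c] fin pq by simp
    qed
    finally have "G (Suc k) = real (card {X \<in> ?T. 0 < X (p, q)})"
      by (simp add: G_def Suc_le_eq)
    then have "real N * G (Suc k) \<le> real (\<Sum>X\<in>?T. ?Z X)"
      using card_tables_min_entry_pos_le[of I J p q ?r ?c] fin pq True N
      by (simp flip: of_nat_mult del: of_nat_sum)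
    \<comment> \<open>An exceptional table is charged for all \<open>N\<close> cells.\<close>
    also have "\<dots> \<le> (\<Sum>X\<in>?T. \<theta> * real N + (if X \<in> ?L then real N else 0))"
      unfolding of_nat_sum
    proof (intro sum_mono)
      fix X assume X: "X \<in> ?T"
      have "?Z X \<le> N" unfolding N using fin by (intro card_mono) (auto simp: support_in_def)
      then show "real (?Z X) \<le> \<theta> * real N + (if X \<in> ?L then real N else 0)"
        using X \<theta> by (auto simp: add_increasing)
    qed
    also have "\<dots> = \<theta> * real N * G k + real N * real (card ?L)"
      using finT by (simp add: sum.distrib Gk flip: sum.inter_filter)
    also have "\<dots> \<le> \<theta> * real N * G k + real N * (D * G 0)"
    proof (intro add_left_mono mult_left_mono)
      \<comment> \<open>With \<open>k < s\<close> and \<open>h + s \<le> m\<close>, the lowered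
        total is still at least \<open>h\<close>.\<close>
      have "sum ?r I + k = m"
        using sum.remove[OF fin(1) pq(1), of ?r] sum.remove[OF fin(1) pq(1), of "\<lambda>_. s"] True m(1)
        by (simp add: mult.commute)
      then show "real (card ?L) \<le> D * G 0"
        using card_tables_large_support[of I J m s t N ?r h "\<theta> * real N" ?c] fin pq m N h True
        by (auto simp: D_def G_def)
    qed simp
    finally have "real N * G (Suc k) \<le> real N * (\<theta> * G k + D * G 0)"
      by (simp add: algebra_simps)
    then show ?thesis using N0 by simp
  qed
qed

text \<open>Iterating the linear recursion: relative to \<open>G 0\<close>,
  \<open>D / (1 - \<theta>)\<close> is the fixed point of the map sending x to \<theta> x +
  D.\<close>

lemma card_tables_entry_ge_bound:
  assumes fin: "finite I" "finite J" and pq: "p \<in> I" "q \<in> J"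
    and m: "m = s * card I" "m = t * card J" "0 < m" and N: "N = card (I \<times> J)"
    and h: "h + s \<le> m" "real h < \<theta> * real N" and \<theta>: "0 \<le> \<theta>" "\<theta> < 1"
  defines "D \<equiv> (real N * real m / ((\<theta> * real N - real h) * real (m + N - 1))) ^ h
      * real (m + 1) ^ (card I + card J)"
  shows "real (card {X \<in> tables I J (\<lambda>_. s) (\<lambda>_. t). k \<le> X (p, q)})
      \<le> (\<theta> ^ k + D / (1 - \<theta>)) * real (card (tables I J (\<lambda>_. s) (\<lambda>_. t)))"
proof -
  define G where "G = (\<lambda>k. real (card {X \<in> tables I J (\<lambda>_. s) (\<lambda>_. t). k \<le> X (p, q)}))"
  have D0: "0 \<le> D" unfolding D_def using h(2) by (intro mult_nonneg_nonneg) auto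
  have G0: "0 \<le> G k" for k by (simp add: G_def)
  have step: "G (Suc k) \<le> \<theta> * G k + D * G 0" for k
    unfolding G_def D_def by (rule card_tables_entry_ge_step) (use assms in auto)
  have "G k \<le> (\<theta> ^ k + D / (1 - \<theta>)) * G 0"
  proof (induction k)
    case 0
    have "0 \<le> D / (1 - \<theta>) * G 0" using D0 G0 \<theta> by simp
    then show ?case by (simp add: algebra_simps)
  next
    case (Suc k)
    have "G (Suc k) \<le> \<theta> * ((\<theta> ^ k + D / (1 - \<theta>)) * G 0) + D * G 0"
      using step[of k] mult_left_mono[OF Suc.IH \<theta>(1)] by linarith
    also have "\<dots> = (\<theta> ^ Suc k + D / (1 - \<theta>)) * G 0"
      using \<theta> by (simp add: field_simps)
    finally show ?case .
  qed
  then show ?thesis by (simp add: G_def)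
qed

subsection \<open>The maximal entry\<close>

text \<open>Matrices correspond to tables by extension with 0. The case \<open>k = 0\<close>
  compares the full sets and so supplies the normalising constant.\<close>

lemma card_uniform_margin_mats_entry_ge:
  assumes "i < n" "j < n"
  shows "card {A \<in> uniform_margin_mats s n. k \<le> A $$ (i, j)}
       = card {X \<in> tables {..<n} {..<n} (\<lambda>_. s) (\<lambda>_. s). k \<le> X (i, j)}"
proof -
  let ?g = "\<lambda>A (i, j). if i < n \<and> j < n then A $$ (i, j) else 0 :: nat"
  have "bij_betw ?g {A \<in> uniform_margin_mats s n. k \<le> A $$ (i, j)}
      {X \<in> tables {..<n} {..<n} (\<lambda>_. s) (\<lambda>_. s). k \<le> X (i, j)}"
  proof (rule bij_betw_byWitness[where f' = "mat n n"])
    show "\<forall>A\<in>{A \<in> uniform_margin_mats s n. k \<le> A $$ (i, j)}. mat n n (?g A) = A"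
      by (auto simp: uniform_margin_mats_def intro!: eq_matI)
    show "\<forall>X\<in>{X \<in> tables {..<n} {..<n} (\<lambda>_. s) (\<lambda>_. s). k \<le> X (i, j)}. ?g (mat n n X) = X"
      by (auto simp: tables_def fun_eq_iff)
  qed (use assms in \<open>auto simp: uniform_margin_mats_def tables_def\<close>)
  then show ?thesis by (rule bij_betw_same_card)
qed

text \<open>A union bound over the n^2 entries: an integer above \<open>t\<close> is at least
  \<open>k\<close>.\<close>

lemma prob_max_entry_le:
  assumes n: "0 < n" and ne: "uniform_margin_mats s n \<noteq> {}" and k: "k = nat \<lceil>t\<rceil>"
    and b: "\<And>i j. i < n \<Longrightarrow> j < n \<Longrightarrow>
      real (card {X \<in> tables {..<n} {..<n} (\<lambda>_. s) (\<lambda>_. s). k \<le> X (i, j)})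
        \<le> b * real (card (tables {..<n} {..<n} (\<lambda>_. s) (\<lambda>_. s)))"
  shows "measure_pmf.prob (pmf_of_set (uniform_margin_mats s n))
      {X. t < real (Max {X $$ (i, j) | i j. i < n \<and> j < n})} \<le> real n ^ 2 * b"
proof -
  let ?U = "uniform_margin_mats s n" and ?P = "{..<n} \<times> {..<n}"
  let ?E = "{X. t < real (Max {X $$ (i, j) | i j. i < n \<and> j < n})}"
  have fin: "finite ?U" by (rule finite_uniform_margin_mats)
  have U0: "0 < card ?U" using ne fin by (simp add: card_gt_0_iff)
  have eq: "{X $$ (i, j) | i j. i < n \<and> j < n} = (\<lambda>x. X $$ x) ` ?P" for X :: "nat mat"
    by auto
  have "?U \<inter> ?E \<subseteq> (\<Union>x\<in>?P. {A \<in> ?U. k \<le> A $$ x})"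
  proof
    fix A assume A: "A \<in> ?U \<inter> ?E"
    have "Max ((\<lambda>x. A $$ x) ` ?P) \<in> (\<lambda>x. A $$ x) ` ?P" using n by (intro Max_in) auto
    then obtain x where x: "x \<in> ?P" "Max ((\<lambda>x. A $$ x) ` ?P) = A $$ x" by auto
    with A have "k \<le> A $$ x" unfolding eq k by simp
    with A x(1) show "A \<in> (\<Union>x\<in>?P. {A \<in> ?U. k \<le> A $$ x})" by blast
  qed
  then have "card (?U \<inter> ?E) \<le> card (\<Union>x\<in>?P. {A \<in> ?U. k \<le> A $$ x})"
    using fin by (intro card_mono) auto
  also have "\<dots> \<le> (\<Sum>x\<in>?P. card {A \<in> ?U. k \<le> A $$ x})"
    by (intro card_UN_le) auto
  finally have "real (card (?U \<inter> ?E)) \<le> (\<Sum>x\<in>?P. real (card {A \<in> ?U. k \<le> A $$ x}))"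
    by (simp flip: of_nat_sum)
  also have "\<dots> \<le> (\<Sum>x\<in>?P. b * real (card ?U))"
  proof (intro sum_mono)
    fix x assume "x \<in> ?P"
    then obtain i j where x: "x = (i, j)" "i < n" "j < n" by auto
    show "real (card {A \<in> ?U. k \<le> A $$ x}) \<le> b * real (card ?U)"
      using b[OF x(2,3)] card_uniform_margin_mats_entry_ge[OF x(2,3), of s k]
        card_uniform_margin_mats_entry_ge[OF x(2,3), of s 0] x(1) by simp
  qed
  also have "\<dots> = real n ^ 2 * b * real (card ?U)"
    by (simp add: power2_eq_square)
  finally show ?thesis
    using U0 ne fin by (simp add: measure_pmf_of_set divide_le_eq)
qed

lemma prob_max_entry_bound:
  fixes C n :: nat and \<theta> \<gamma> t :: real
  assumes C: "2 \<le> C" and n: "2 \<le> n" and \<gamma>: "0 \<le> \<gamma>" "\<gamma> < \<theta>" "\<theta> < 1"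
  defines "\<beta> \<equiv> real C * real n ^ 2 / ((\<theta> - \<gamma>) * ((real C + 1) * real n ^ 2 - 1))"
  shows "measure_pmf.prob (pmf_of_set (uniform_margin_mats (C * n) n))
      {X. t < real (Max {X $$ (i, j) | i j. i < n \<and> j < n})}
    \<le> real n ^ 2 * (\<theta> powr t + \<beta> ^ nat \<lfloor>\<gamma> * real n ^ 2\<rfloor> * (real C * real n ^ 2 + 1) ^ (2 * n) / (1 - \<theta>))"
proof -
  define h where "h = nat \<lfloor>\<gamma> * real n ^ 2\<rfloor>"
  define N where "N = n ^ 2"
  define m where "m = C * N"
  define k where "k = nat \<lceil>t\<rceil>"
  let ?D = "(real N * real m / ((\<theta> * real N - real h) * real (m + N - 1))) ^ h
      * real (m + 1) ^ (card {..<n} + card {..<n})"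
  have N4: "4 \<le> N" unfolding N_def using power_mono[OF n, of 2] by simp
  have h_le: "real h \<le> \<gamma> * real N" using \<gamma> by (simp add: h_def N_def)
  have \<gamma>N: "\<gamma> * real N < \<theta> * real N" using \<gamma> N4 by simp
  have h_less: "real h < \<theta> * real N" using h_le \<gamma>N by linarith
  have "\<gamma> * real N \<le> 1 * real N" using \<gamma> by (intro mult_right_mono) auto
  with h_le have "h \<le> N" by simp
  \<comment> \<open>After division by \<open>n\<close> this is n + C \<le> C n, that is (C - 1) (n -
    1) \<ge> 1, which holds as both numbers are at least 2.\<close>
  moreover have "N + C * n \<le> m"
  proof -
    have "n + C \<le> C * n"
    proof -
      obtain a b where "C = a + 2" "n = b + 2" using C n by (metis add.commute le_Suc_ex)
      then show ?thesis by simp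
    qed
    then have "n * (n + C) \<le> n * (C * n)" by (rule mult_le_mono2)
    then show ?thesis by (simp add: m_def N_def power2_eq_square algebra_simps)
  qed
  ultimately have hs: "h + C * n \<le> m" by simp
  \<comment> \<open>Since \<open>h\<close> is at most \<open>\<gamma> * real N\<close>, the factor
    \<open>\<theta> * real N - real h\<close> is at least
    \<open>(\<theta> - \<gamma>) * real N\<close>, and \<open>real N\<close> cancels.\<close>
  have D_le: "?D \<le> \<beta> ^ h * (real C * real n ^ 2 + 1) ^ (2 * n)"
  proof -
    have mN: "real (m + N - 1) = (real C + 1) * real N - 1"
      using N4 by (simp add: m_def of_nat_diff algebra_simps)
    have pos: "0 < (real C + 1) * real N - 1"
      using N4 unfolding mN[symmetric] by simp
    have "real N * real m / ((\<theta> * real N - real h) * real (m + N - 1))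
        \<le> real N * real m / (((\<theta> - \<gamma>) * real N) * real (m + N - 1))"
      using h_le h_less \<gamma> N4 pos unfolding mN
      by (intro divide_left_mono mult_right_mono mult_pos_pos) (auto simp: algebra_simps)
    also have "\<dots> = \<beta>"
      unfolding \<beta>_def mN using N4 by (simp add: m_def N_def)
    finally have "(real N * real m / ((\<theta> * real N - real h) * real (m + N - 1))) ^ h \<le> \<beta> ^ h"
      using h_less by (intro power_mono) auto
    moreover have "real (m + 1) ^ (card {..<n} + card {..<n}) = (real C * real n ^ 2 + 1) ^ (2 * n)"
      by (simp add: m_def N_def mult_2 add.commute)
    ultimately show ?thesis by (simp add: mult_right_mono)
  qed
  have "measure_pmf.prob (pmf_of_set (uniform_margin_mats (C * n) n))
      {X. t < real (Max {X $$ (i, j) | i j. i < n \<and> j < n})}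
    \<le> real n ^ 2 * (\<theta> ^ k + ?D / (1 - \<theta>))"
  proof (rule prob_max_entry_le)
    fix i j assume "i < n" "j < n"
    then show "real (card {X \<in> tables {..<n} {..<n} (\<lambda>_. C * n) (\<lambda>_. C * n). k \<le> X (i, j)})
        \<le> (\<theta> ^ k + ?D / (1 - \<theta>)) * real (card (tables {..<n} {..<n} (\<lambda>_. C * n) (\<lambda>_. C * n)))"
      using C n \<gamma> hs h_less N4
      by (intro card_tables_entry_ge_bound)
        (auto simp: m_def N_def power2_eq_square card_cartesian_product)
  qed (use n in \<open>auto simp: k_def uniform_margin_mats_nonempty real_nat_ceiling_ge\<close>)
  also have "\<dots> \<le> real n ^ 2 * (\<theta> powr t + \<beta> ^ h * (real C * real n ^ 2 + 1) ^ (2 * n) / (1 - \<theta>))"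
  proof (intro mult_left_mono add_mono divide_right_mono D_le)
    have "\<theta> ^ k = \<theta> powr real k" using \<gamma> by (simp add: powr_realpow)
    also have "\<dots> \<le> \<theta> powr t"
      using \<gamma> by (intro powr_mono') (auto simp: k_def real_nat_ceiling_ge)
    finally show "\<theta> ^ k \<le> \<theta> powr t" .
  qed (use \<gamma> in auto)
  finally show ?thesis unfolding h_def .
qed

theorem theorem1p5:
  fixes C :: nat and \<epsilon> :: real
  assumes "C \<ge> 2" and "\<epsilon> > 0"
  shows "(\<lambda>n::nat. measure_pmf.prob (pmf_of_set (uniform_margin_mats (C * n) n))
            {X. real (Max {X $$ (i,j) | i j. i < n \<and> j < n})
                > 1 / ln ((real C + 1) / real C)
                    * ln (real C / (1 + real C) * real n powr (2 + \<epsilon>))})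
         \<longlonglongrightarrow> 0"
proof -
  define \<rho> where "\<rho> = real C / (real C + 1)"
  \<comment> \<open>Chosen so that (1 - \<delta>) (2 + \<epsilon>) = 2 + \<epsilon> / 2: half of the
    spare exponent survives the replacement of \<open>\<rho>\<close> by the larger
    \<open>\<theta>\<close>.\<close>
  define \<delta> where "\<delta> = \<epsilon> / (2 * (2 + \<epsilon>))"
  define \<theta> where "\<theta> = \<rho> powr (1 - \<delta>)"
  \<comment> \<open>Then \<open>\<theta> - \<gamma>\<close> is the midpoint \<open>\<sigma>\<close>
    of \<open>\<rho>\<close> and \<open>\<theta>\<close>. The base \<open>B n\<close> of the error
    term tends to \<open>\<rho> / \<sigma> < 1\<close>, while its exponent still grows like
    n^2.\<close>
  define \<gamma> where "\<gamma> = (\<theta> - \<rho>) / 2"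
  define \<sigma> where "\<sigma> = (\<theta> + \<rho>) / 2"
  define t where "t = (\<lambda>n::nat. 1 / ln ((real C + 1) / real C)
                    * ln (real C / (1 + real C) * real n powr (2 + \<epsilon>)))"
  define B where "B = (\<lambda>n::nat. real C * real n ^ 2 / ((\<theta> - \<gamma>) * ((real C + 1) * real n ^ 2 - 1)))"
  have \<rho>: "0 < \<rho>" "\<rho> < 1" using assms by (auto simp: \<rho>_def)
  have \<delta>: "0 < \<delta>" "\<delta> < 1" using assms by (auto simp: \<delta>_def field_simps)
  have "\<rho> powr 1 < \<rho> powr (1 - \<delta>)" using \<rho> \<delta> by (intro powr_less_mono') auto
  then have \<theta>_gt: "\<rho> < \<theta>" using \<rho> by (simp add: \<theta>_def)
  have \<theta>_lt: "\<theta> < 1" using \<rho> \<delta> powr_less_mono'[of \<rho> 0 "1 - \<delta>"] by (simp add: \<theta>_def)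
  have \<gamma>: "0 < \<gamma>" "\<gamma> < \<theta>" "\<theta> - \<gamma> = \<sigma>" using \<rho> \<theta>_gt by (auto simp: \<gamma>_def \<sigma>_def field_simps)
  have \<sigma>: "0 < \<sigma>" "\<rho> < \<sigma>" using \<rho> \<theta>_gt by (auto simp: \<sigma>_def)
  have \<rho>\<sigma>: "0 < \<rho> / \<sigma>" "\<rho> / \<sigma> < 1" using \<rho> \<sigma> by auto
  obtain \<beta> where \<beta>: "\<rho> / \<sigma> < \<beta>" "\<beta> < 1"
    using dense[OF \<rho>\<sigma>(2)] by blast
  have \<beta>0: "0 < \<beta>" using \<rho>\<sigma>(1) \<beta>(1) by (rule less_trans)
  define b where "b = - ln \<beta>"
  have b: "0 < b" using \<beta>(2) \<beta>0 by (simp add: b_def)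
  have C0: "0 < real C" using assms by simp

  have "B \<longlonglongrightarrow> real C * (inverse \<sigma> * inverse (real C + 1))"
    unfolding B_def \<gamma>(3) using C0 \<sigma>(1) by real_asymp
  then have "B \<longlonglongrightarrow> \<rho> / \<sigma>" by (simp add: \<rho>_def divide_inverse mult_ac)
  then have B_le: "eventually (\<lambda>n. B n < \<beta>) sequentially"
    by (rule order_tendstoD) (rule \<beta>(1))

  \<comment> \<open>The threshold satisfies \<open>\<rho> powr t n = 1 / (\<rho> * real n powr (2 +
    \<epsilon>))\<close>; raising this to the power \<open>1 - \<delta>\<close> leaves a quantity
    that is o(n^-2).\<close>
  have \<theta>_t: "\<theta> powr t n = \<rho> powr (- (1 - \<delta>)) * real n powr (- 2 - \<epsilon> / 2)" if "0 < n" for n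
  proof -
    have ln_\<rho>: "ln ((real C + 1) / real C) = - ln \<rho>"
      using C0 by (simp add: \<rho>_def ln_div)
    have "ln \<rho> < 0" using \<rho> by simp
    have "(1 - \<delta>) * (2 + \<epsilon>) = 2 + \<epsilon> / 2"
      using assms by (simp add: \<delta>_def field_simps)
    then have e: "- (1 - \<delta>) * (2 + \<epsilon>) = - 2 - \<epsilon> / 2" by linarith
    have "\<theta> powr t n = exp ((1 - \<delta>) * (t n * ln \<rho>))"
      using \<rho> by (simp add: \<theta>_def powr_powr) (simp add: powr_def mult_ac)
    also have "t n * ln \<rho> = - ln (\<rho> * real n powr (2 + \<epsilon>))"
      unfolding t_def ln_\<rho> using \<open>ln \<rho> < 0\<close> by (simp add: \<rho>_def add.commute)
    also have "exp ((1 - \<delta>) * - ln (\<rho> * real n powr (2 + \<epsilon>))) = (\<rho> * real n powr (2 + \<epsilon>)) powr (- (1 - \<delta>))"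
      using \<rho> that by (simp add: powr_def left_diff_distrib)
    also have "\<dots> = \<rho> powr (- (1 - \<delta>)) * real n powr (- 2 - \<epsilon> / 2)"
      using \<rho> unfolding e[symmetric] by (simp add: powr_mult powr_powr mult.commute)
    finally show ?thesis .
  qed

  \<comment> \<open>The \<open>- 1\<close> pays for the floor in the exponent. The exponential
    decays like exp(- b \<gamma> n^2), which beats the power with exponent \<open>2 * n\<close>, of
    size exp(O(n log n)).\<close>
  define R where "R = (\<lambda>n::nat. real n ^ 2 * (\<rho> powr (- (1 - \<delta>)) * real n powr (- 2 - \<epsilon> / 2))
    + real n ^ 2 * exp (- b * (\<gamma> * real n ^ 2 - 1)) * (real C * real n ^ 2 + 1) ^ (2 * n) / (1 - \<theta>))"
  have "R \<longlonglongrightarrow> 0 + 0 / (1 - \<theta>)"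
    unfolding R_def
  proof (intro tendsto_add tendsto_divide tendsto_const)
    have "0 < \<rho> powr (- (1 - \<delta>))" using \<rho> by simp
    then show "(\<lambda>n. real n ^ 2 * (\<rho> powr (- (1 - \<delta>)) * real n powr (- 2 - \<epsilon> / 2))) \<longlonglongrightarrow> 0"
      using assms(2) by real_asymp
    show "(\<lambda>n. real n ^ 2 * exp (- b * (\<gamma> * real n ^ 2 - 1)) * (real C * real n ^ 2 + 1) ^ (2 * n)) \<longlonglongrightarrow> 0"
      using b \<gamma>(1) C0 by real_asymp
  qed (use \<theta>_lt in auto)
  then have R_lim: "R \<longlonglongrightarrow> 0" by simp

  have "eventually (\<lambda>n. measure_pmf.prob (pmf_of_set (uniform_margin_mats (C * n) n))
      {X. t n < real (Max {X $$ (i,j) | i j. i < n \<and> j < n})} \<le> R n) sequentially"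
    using B_le eventually_ge_at_top[of 2]
  proof eventually_elim
    case (elim n)
    let ?h = "nat \<lfloor>\<gamma> * real n ^ 2\<rfloor>"
    have "0 \<le> B n"
    proof -
      have "1 \<le> real n ^ 2" using elim by (simp add: one_le_power)
      then have "0 \<le> (real C + 1) * real n ^ 2 - 1"
        using C0 mult_mono[of 1 "real C + 1" 1 "real n ^ 2"] by simp
      then show ?thesis unfolding B_def using \<gamma> by simp
    qed
    then have "B n ^ ?h \<le> \<beta> ^ ?h" using elim by (intro power_mono) auto
    also have "\<dots> = exp (- b * real ?h)"
      using \<beta>0 by (simp add: b_def powr_realpow[symmetric] powr_def mult.commute)
    also have "\<dots> \<le> exp (- b * (\<gamma> * real n ^ 2 - 1))"
    proof -
      have "\<gamma> * real n ^ 2 - 1 \<le> real ?h" by linarith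
      then show ?thesis using b by simp
    qed
    finally have "B n ^ ?h \<le> exp (- b * (\<gamma> * real n ^ 2 - 1))" .
    then have "real n ^ 2 * (\<theta> powr t n + B n ^ ?h * (real C * real n ^ 2 + 1) ^ (2 * n) / (1 - \<theta>)) \<le>
        real n ^ 2 * (\<theta> powr t n + exp (- b * (\<gamma> * real n ^ 2 - 1)) * (real C * real n ^ 2 + 1) ^ (2 * n) / (1 - \<theta>))"
      using \<theta>_lt by (intro mult_left_mono add_left_mono divide_right_mono mult_right_mono) auto
    also have "\<dots> = R n"
      using elim by (simp add: R_def \<theta>_t distrib_left)
    finally show ?case
      using prob_max_entry_bound[of C n \<gamma> \<theta> "t n"] assms elim \<gamma> \<theta>_lt unfolding B_def by linarith
  qed
  then show ?thesis
    unfolding t_def by (intro real_tendsto_sandwich[OF always_eventually _ tendsto_const R_lim]) auto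
qed

end
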